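(* Let $G=(V,E)$ be a graph on $n=|V|$ vertices and let $\overline G$ be its complement. Let $k$ be an integer with $1\le k<n-1$. Then every eigenvalue $\lambda_J$ of the Laplacian matrix of the Johnson graph $J(n,k)=F_k(K_n)$ is the sum of one Laplacian eigenvalue of $F_k(G)$ and one Laplacian eigenvalue of $F_k(\overline G)$, where each eigenvalue of $F_k(G)$ and each eigenvalue of $F_k(\overline G)$ is used once. That is, with $N=\binom nk$, the Laplacian eigenvalues (listed with multiplicity) of $F_k(G)$, $F_k(\overline G)$ and $J(n,k)$ can be enumerated as $\lambda_1,\dots,\lambda_N$; $\overline\lambda_1,\dots,\overline\lambda_N$; and $\theta_1,\dots,\theta_N$, respectively, so that $$\lambda_i+\overline\lambda_i=\theta_i\qquad\text{for all } i=1,\dots,N.$$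
   Context: All graphs are finite and simple. For a graph $G$ with vertex set $[n]=\{1,\dots,n\}$ and $1\le k\le n$, the $k$-token graph $F_k(G)$ has as vertices the $k$-subsets of $[n]$; two vertices $A,B$ are adjacent iff $A\bigtriangleup B=\{a,b\}$ with $a\in A$, $b\in B$ and $\{a,b\}$ an edge of $G$. The Johnson graph $J(n,k)$ is the $k$-token graph $F_k(K_n)$ of the complete graph $K_n$. The Laplacian matrix of a graph is the diagonal degree matrix minus the adjacency matrix. *)

theory Defs
  imports
    "Graph_Theory.Graph_Theory"
    "Jordan_Normal_Form.Char_Poly"
begin

text \<open>
  A finite simple graph is a \<open>pair_graph\<close>: a finite, symmetric, loop-free digraph without parallel
  arcs. The edge \<open>{a,b}\<close> is the pair of arcs \<open>(a,b)\<close> and \<open>(b,a)\<close>, so the degree of a vertex is its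
  \<open>out_degree\<close>.
\<close>

definition graph_complement :: "'a pair_pre_digraph \<Rightarrow> 'a pair_pre_digraph" where
  "graph_complement G =
     \<lparr> pverts = pverts G,
       parcs = {(u, v). u \<in> pverts G \<and> v \<in> pverts G \<and> u \<noteq> v \<and> (u, v) \<notin> parcs G} \<rparr>"

definition complete_graph :: "nat \<Rightarrow> nat pair_pre_digraph" where
  "complete_graph n =
     \<lparr> pverts = {1..n}, parcs = {(u, v). u \<in> {1..n} \<and> v \<in> {1..n} \<and> u \<noteq> v} \<rparr>"

definition token_graph :: "nat \<Rightarrow> 'a pair_pre_digraph \<Rightarrow> 'a set pair_pre_digraph" where
  "token_graph k G =
     (let W = {A. A \<subseteq> pverts G \<and> card A = k} in
      \<lparr> pverts = W,
        parcs = {(A, B). A \<in> W \<and> B \<in> W \<and>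
          (\<exists>a\<in>A. \<exists>b\<in>B. (A - B) \<union> (B - A) = {a, b} \<and> (a, b) \<in> parcs G)} \<rparr>)"

definition johnson_graph :: "nat \<Rightarrow> nat \<Rightarrow> nat set pair_pre_digraph" where
  "johnson_graph n k = token_graph k (complete_graph n)"

text \<open>
  Matrices are indexed by \<open>0, \<dots>, card (pverts G) - 1\<close>, so the vertices of a finite graph are put
  into an arbitrary fixed order. Another order conjugates the matrices below by a permutation matrix
  and leaves the characteristic polynomial unchanged.
\<close>

definition vertex_list :: "'a pair_pre_digraph \<Rightarrow> 'a list" where
  "vertex_list G = (SOME vs. distinct vs \<and> set vs = pverts G)"

definition degree_matrix :: "'a pair_pre_digraph \<Rightarrow> real mat" where
  "degree_matrix G = mat (card (pverts G)) (card (pverts G))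
     (\<lambda>(i, j). if i = j then real (out_degree (with_proj G) (vertex_list G ! i)) else 0)"

definition adjacency_matrix :: "'a pair_pre_digraph \<Rightarrow> real mat" where
  "adjacency_matrix G = mat (card (pverts G)) (card (pverts G))
     (\<lambda>(i, j). if (vertex_list G ! i, vertex_list G ! j) \<in> parcs G then 1 else 0)"

definition laplacian_matrix :: "'a pair_pre_digraph \<Rightarrow> real mat" where
  "laplacian_matrix G = degree_matrix G - adjacency_matrix G"

text \<open>
  \<open>ev 1, \<dots>, ev m\<close> lists all Laplacian eigenvalues of \<open>G\<close> with multiplicity. As the characteristic
  polynomial has degree \<open>card (pverts G)\<close>, this forces \<open>m = card (pverts G)\<close>.
\<close>

definition enumerates_laplacian_eigenvalues ::
    "'a pair_pre_digraph \<Rightarrow> nat \<Rightarrow> (nat \<Rightarrow> real) \<Rightarrow> bool" where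
  "enumerates_laplacian_eigenvalues G m ev \<longleftrightarrow>
     char_poly (laplacian_matrix G) = (\<Prod>i=1..m. [:- ev i, 1:])"


lemma vertex_list:
  assumes "finite (pverts G)"
  shows "distinct (vertex_list G)" "set (vertex_list G) = pverts G"
        "length (vertex_list G) = card (pverts G)"
proof -
  have "\<exists>vs. distinct vs \<and> set vs = pverts G"
    using finite_distinct_list[OF assms] by blast
  then have *: "distinct (vertex_list G) \<and> set (vertex_list G) = pverts G"
    unfolding vertex_list_def by (rule someI_ex)
  then show "distinct (vertex_list G)" "set (vertex_list G) = pverts G" by auto
  with distinct_card show "length (vertex_list G) = card (pverts G)" by fastforce
qed

lemma pair_graphI:
  assumes "finite (pverts G)" "parcs G \<subseteq> pverts G \<times> pverts G"
    and "\<And>u v. (u, v) \<in> parcs G \<Longrightarrow> (v, u) \<in> parcs G \<and> u \<noteq> v"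
  shows "pair_graph G"
proof -
  have "finite (parcs G)" using assms(1,2) by (meson finite_SigmaI finite_subset)
  with assms show ?thesis
    by unfold_locales (auto simp: symmetric_def intro!: symI)
qed

lemma pair_graph_complement:
  assumes "pair_graph G"
  shows "pair_graph (graph_complement G)"
proof -
  interpret pair_graph G by fact
  have "(u, v) \<in> parcs G \<longleftrightarrow> (v, u) \<in> parcs G" for u v
    using pair_sym_arcs by (auto simp: symmetric_def dest: symD)
  then show ?thesis
    by (intro pair_graphI) (auto simp: graph_complement_def pair_finite_verts)
qed

lemma pair_graph_complete: "pair_graph (complete_graph n)"
  by (rule pair_graphI) (auto simp: complete_graph_def)

lemma complete_digraph_complete_graph: "K\<^bsub>n\<^esub> (with_proj (complete_graph n))"
  using pair_graph_complete[of n]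
  by (auto simp: complete_digraph_pair_def complete_graph_def pair_graph_def pair_digraph_def)

lemma pair_graph_token:
  assumes "pair_graph G"
  shows "pair_graph (token_graph k G)"
proof -
  interpret pair_graph G by fact
  have sym: "(v, u) \<in> parcs G" if "(u, v) \<in> parcs G" for u v
    using pair_sym_arcs that by (auto simp: symmetric_def dest: symD)
  show ?thesis
  proof (rule pair_graphI)
    show "finite (pverts (token_graph k G))"
      by (simp add: token_graph_def pair_finite_verts)
    show "parcs (token_graph k G) \<subseteq> pverts (token_graph k G) \<times> pverts (token_graph k G)"
      unfolding token_graph_def Let_def by force
  next
    fix A B assume AB: "(A, B) \<in> parcs (token_graph k G)"
    then obtain a b where ab: "a \<in> A" "b \<in> B" "(A - B) \<union> (B - A) = {a, b}" "(a, b) \<in> parcs G"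
      unfolding token_graph_def Let_def by auto
    from ab(3) have ba: "(B - A) \<union> (A - B) = {b, a}" by (simp only: Un_commute insert_commute)
    have "\<exists>b\<in>B. \<exists>a\<in>A. (B - A) \<union> (A - B) = {b, a} \<and> (b, a) \<in> parcs G"
      by (rule bexI[of _ b], rule bexI[of _ a], rule conjI, rule ba, rule sym, rule ab(4), rule ab(1), rule ab(2))
    moreover have "A \<in> pverts (token_graph k G)" "B \<in> pverts (token_graph k G)"
      using AB unfolding token_graph_def Let_def by simp_all
    ultimately have "(B, A) \<in> parcs (token_graph k G)"
      unfolding token_graph_def Let_def by simp
    moreover have "A \<noteq> B" using ab(3) by blast
    ultimately show "(B, A) \<in> parcs (token_graph k G) \<and> A \<noteq> B" ..
  qed
qed

lemma card_pverts_token_graph: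
  assumes "finite (pverts G)"
  shows "card (pverts (token_graph k G)) = card (pverts G) choose k"
  using n_subsets[OF assms] by (simp add: token_graph_def)

end

theory Submission
  imports Defs "Jordan_Normal_Form.Schur_Decomposition"
begin

text \<open>
  Let \<open>K\<close> be the complete graph on the vertices of \<open>G\<close>. Writing \<open>P\<^sub>\<tau>\<close> for the action of a transposition
  on \<open>k\<close>-sets, the Laplacian of \<open>F\<^sub>k(G)\<close> is the sum of \<open>I - P\<^sub>\<tau>\<close> over the edges \<open>\<tau> = (a b)\<close> of \<open>G\<close>. It is
  therefore additive over disjoint edge sets, and it commutes with the Laplacian of \<open>F\<^sub>k(K)\<close>, which is
  invariant under all vertex permutations. Hence the Laplacians of \<open>F\<^sub>k(G)\<close> and of \<open>F\<^sub>k\<close> of the complement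
  are commuting symmetric matrices with sum the Laplacian of \<open>F\<^sub>k(K)\<close>, and a simultaneous triangularisation
  pairs their eigenvalues.
\<close>

section \<open>Commuting matrices\<close>

text \<open>
  If \<open>m\<close> is the last index in the support of \<open>v\<close>, then \<open>B v - B\<^sub>m\<^sub>m v\<close> is zero (and \<open>v\<close> is an eigenvector
  of \<open>B\<close>) or it is an \<open>e\<close>-eigenvector of \<open>A\<close> with smaller support.
\<close>

lemma triangular_common_eigenvector:
  fixes A B :: "'a :: field mat"
  assumes A: "A \<in> carrier_mat n n" and B: "B \<in> carrier_mat n n"
    and comm: "A * B = B * A" and ut: "upper_triangular B"
    and v: "v \<in> carrier_vec n" "v \<noteq> 0\<^sub>v n" "A *\<^sub>v v = e \<cdot>\<^sub>v v"
    and supp: "\<And>i. m \<le> i \<Longrightarrow> i < n \<Longrightarrow> v $ i = 0" and "m \<le> n"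
  shows "\<exists>w f. w \<in> carrier_vec n \<and> w \<noteq> 0\<^sub>v n \<and> A *\<^sub>v w = e \<cdot>\<^sub>v w \<and> B *\<^sub>v w = f \<cdot>\<^sub>v w"
  using v supp \<open>m \<le> n\<close>
proof (induction m arbitrary: v)
  case 0
  then have "v = 0\<^sub>v n" by (intro eq_vecI) auto
  with 0 show ?case by simp
next
  case (Suc m)
  define b where "b = B $$ (m, m)"
  define w where "w = B *\<^sub>v v - b \<cdot>\<^sub>v v"
  have w: "w \<in> carrier_vec n" using B Suc.prems by (auto simp: w_def)
  have "A *\<^sub>v w = A *\<^sub>v (B *\<^sub>v v) - b \<cdot>\<^sub>v (A *\<^sub>v v)"
    unfolding w_def using A B Suc.prems
    by (simp add: mult_minus_distrib_mat_vec mult_mat_vec[OF A])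
  also have "A *\<^sub>v (B *\<^sub>v v) = B *\<^sub>v (A *\<^sub>v v)"
    using A B Suc.prems comm by (metis assoc_mult_mat_vec)
  also have "\<dots> = e \<cdot>\<^sub>v (B *\<^sub>v v)"
    using B Suc.prems by (simp add: mult_mat_vec[OF B])
  also have "e \<cdot>\<^sub>v (B *\<^sub>v v) - b \<cdot>\<^sub>v (A *\<^sub>v v) = e \<cdot>\<^sub>v w"
    unfolding w_def Suc.prems(3) using B Suc.prems(1)
    by (intro eq_vecI) (auto simp: algebra_simps)
  finally have Aw: "A *\<^sub>v w = e \<cdot>\<^sub>v w" .
  show ?case
  proof (cases "w = 0\<^sub>v n")
    case True
    have "B *\<^sub>v v = b \<cdot>\<^sub>v v"
    proof (rule eq_vecI)
      fix i assume "i < dim_vec (b \<cdot>\<^sub>v v)"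
      then have i: "i < n" using Suc.prems by simp
      have "w $ i = 0" using True i by simp
      with i show "(B *\<^sub>v v) $ i = (b \<cdot>\<^sub>v v) $ i"
        unfolding w_def using B Suc.prems(1) by simp
    qed (use B Suc.prems in auto)
    with Suc.prems show ?thesis by blast
  next
    case False
    \<comment> \<open>For \<open>i\<close> at least \<open>m\<close>, row \<open>i\<close> of
      \<open>B\<close> meets \<open>v\<close> only in coordinate \<open>m\<close>: earlier entries
      vanish by triangularity, later coordinates of \<open>v\<close> by the support bound. What
      remains is \<open>b * v $ m\<close> if \<open>i = m\<close> and zero otherwise.\<close>
    have "w $ i = 0" if "m \<le> i" "i < n" for i
    proof -
      have "(B *\<^sub>v v) $ i = (\<Sum>j<n. B $$ (i, j) * v $ j)"
        using that B Suc.prems(1) by (auto simp: scalar_prod_def lessThan_atLeast0)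
      also have "\<dots> = (\<Sum>j<n. if j = m then B $$ (i, m) * v $ m else 0)"
      proof (rule sum.cong[OF refl])
        fix j assume j: "j \<in> {..<n}"
        consider "j < m" | "j = m" | "Suc m \<le> j" by linarith
        then show "B $$ (i, j) * v $ j = (if j = m then B $$ (i, m) * v $ m else 0)"
        proof cases
          case 1
          then have "B $$ (i, j) = 0" using ut that B by auto
          with 1 show ?thesis by simp
        qed (use Suc.prems j in auto)
      qed
      also have "\<dots> = B $$ (i, m) * v $ m"
        using Suc.prems by simp
      also have "\<dots> = b * v $ i"
        using that ut B Suc.prems(4)[of i] by (cases "i = m") (auto simp: b_def)
      finally show ?thesis using that Suc.prems(1) B by (simp add: w_def)
    qed
    then show ?thesis using Suc.IH[OF w False Aw] Suc.prems by auto
  qed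
qed

text \<open>A Schur decomposition brings \<open>B\<close> to triangular form, and conjugating
  \<open>A\<close> by the same basis change preserves commutation, so the triangular case applies to
  any eigenvector of the conjugated \<open>A\<close>. Algebraic closedness supplies both the Schur
  form and that eigenvector.\<close>

lemma commuting_common_eigenvector:
  fixes A B :: "complex mat"
  assumes A: "A \<in> carrier_mat n n" and B: "B \<in> carrier_mat n n"
    and comm: "A * B = B * A" and n: "n \<noteq> 0"
  shows "\<exists>v e f. v \<in> carrier_vec n \<and> v \<noteq> 0\<^sub>v n \<and> A *\<^sub>v v = e \<cdot>\<^sub>v v \<and> B *\<^sub>v v = f \<cdot>\<^sub>v v"
proof -
  from char_poly_factorized[OF B] obtain bs
    where "char_poly B = (\<Prod>a\<leftarrow>bs. [:- a, 1:])" by blast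
  from schur_decomposition_exists[OF B this] obtain T
    where T: "T \<in> carrier_mat n n" "upper_triangular T" "similar_mat B T" by blast
  then obtain P Q where "similar_mat_wit B T P Q" by (auto simp: similar_mat_def)
  note PQ = similar_mat_witD2[OF B this]
  have P: "P \<in> carrier_mat n n" and Q: "Q \<in> carrier_mat n n" and QP: "Q * P = 1\<^sub>m n"
    and PQ1: "P * Q = 1\<^sub>m n" and BT: "B = P * T * Q"
    using PQ by auto
  define S where "S = Q * A * P"
  have S: "S \<in> carrier_mat n n" using A P Q by (simp add: S_def)
  have T_eq: "T = Q * B * P"
  proof -
    have "Q * B * P = (Q * P) * T * (Q * P)"
      unfolding BT using P Q T(1) by (simp add: assoc_mult_mat[of _ n n _ n _ n])
    then show ?thesis using T(1) QP by simp
  qed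
  have conj: "(Q * X * P) * (Q * Y * P) = Q * (X * Y) * P"
    if "X \<in> carrier_mat n n" "Y \<in> carrier_mat n n" for X Y
  proof -
    have "(Q * X * P) * (Q * Y * P) = Q * X * (P * Q) * Y * P"
      using that P Q by (simp add: assoc_mult_mat[of _ n n _ n _ n])
    also have "\<dots> = Q * (X * Y) * P"
      unfolding PQ1 using that P Q by (simp add: assoc_mult_mat[of _ n n _ n _ n])
    finally show ?thesis .
  qed
  have ST: "S * T = T * S"
    unfolding S_def T_eq using conj[OF A B] conj[OF B A] comm by simp
  from char_poly_factorized[OF S] obtain ss
    where ss: "char_poly S = (\<Prod>a\<leftarrow>ss. [:- a, 1:])" "length ss = n" by blast
  then obtain e where "poly (char_poly S) e = 0"
    using n by (cases ss) auto
  then have "eigenvalue S e" using eigenvalue_root_char_poly[OF S] by simp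
  then obtain v where v: "v \<in> carrier_vec n" "v \<noteq> 0\<^sub>v n" "S *\<^sub>v v = e \<cdot>\<^sub>v v"
    using S by (auto simp: eigenvalue_def eigenvector_def)
  \<comment> \<open>With the support bound \<open>n\<close> the vanishing condition is vacuous, so
    any eigenvector of \<open>S\<close> can start the descent.\<close>
  from triangular_common_eigenvector[OF S T(1) ST T(2) v, of n] obtain w f
    where w: "w \<in> carrier_vec n" "w \<noteq> 0\<^sub>v n" "S *\<^sub>v w = e \<cdot>\<^sub>v w" "T *\<^sub>v w = f \<cdot>\<^sub>v w"
    by auto
  have transfer: "X *\<^sub>v (P *\<^sub>v w) = c \<cdot>\<^sub>v (P *\<^sub>v w)"
    if X: "X \<in> carrier_mat n n" and "(Q * X * P) *\<^sub>v w = c \<cdot>\<^sub>v w" for X c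
  proof -
    have "X *\<^sub>v (P *\<^sub>v w) = (P * Q) *\<^sub>v (X *\<^sub>v (P *\<^sub>v w))"
      unfolding PQ1 using X P w by simp
    also have "\<dots> = P *\<^sub>v ((Q * X * P) *\<^sub>v w)"
      using X P Q w by (simp add: assoc_mult_mat_vec[of _ n n _ n])
    also have "\<dots> = c \<cdot>\<^sub>v (P *\<^sub>v w)"
      unfolding that(2) using P w by (simp add: mult_mat_vec[OF P])
    finally show ?thesis .
  qed
  have "P *\<^sub>v w \<noteq> 0\<^sub>v n"
  proof
    assume 0: "P *\<^sub>v w = 0\<^sub>v n"
    have "w = (Q * P) *\<^sub>v w" using QP w by simp
    also have "\<dots> = Q *\<^sub>v (P *\<^sub>v w)" using P Q w by simp
    also have "\<dots> = 0\<^sub>v n" unfolding 0 using Q by (intro eq_vecI) auto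
    finally show False using w by simp
  qed
  moreover have "P *\<^sub>v w \<in> carrier_vec n" using P w by simp
  ultimately show ?thesis
    using transfer[OF A w(3)[unfolded S_def]] transfer[OF B w(4)[unfolded T_eq]] by blast
qed

text \<open>The basis change is built from \<open>v\<close> alone: \<open>v\<close> is completed to
  a basis, which is orthogonalised with \<open>v\<close> kept in front. Hence one pair
  \<open>P\<close>, \<open>Q\<close> serves every matrix with eigenvector \<open>v\<close>, in
  particular two commuting matrices and their sum.\<close>

lemma eigenvector_first_column:
  fixes v :: "'a :: conjugatable_ordered_field vec"
  assumes v: "v \<in> carrier_vec n" "v \<noteq> 0\<^sub>v n" and n: "n \<noteq> 0"
  shows "\<exists>P Q. P \<in> carrier_mat n n \<and> Q \<in> carrier_mat n n \<and> P * Q = 1\<^sub>m n \<and> Q * P = 1\<^sub>m n \<and>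
    (\<forall>A e. A \<in> carrier_mat n n \<longrightarrow> A *\<^sub>v v = e \<cdot>\<^sub>v v \<longrightarrow>
      col (Q * A * P) 0 = vec n (\<lambda>i. if i = 0 then e else 0))"
proof -
  interpret cof_vec_space n "TYPE('a)" .
  define b where "b = basis_completion v"
  define ws where "ws = gram_schmidt n b"
  define P where "P = mat_of_cols n ws"
  from basis_completion[OF v, folded b_def]
  have b: "distinct b" "\<not> lin_dep (set b)" "set b \<subseteq> carrier_vec n" "hd b = v" "length b = n"
    by auto
  then obtain vs where bv: "b = v # vs" using n by (cases b) auto
  from gram_schmidt_result[OF b(3,1,2) refl, folded ws_def]
  have ws: "set ws \<subseteq> carrier_vec n" "corthogonal ws" "length ws = n" by (auto simp: b)
  have hd: "hd ws = v" using gram_schmidt_hd[OF v(1), of vs] by (simp add: ws_def bv)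
  have P: "P \<in> carrier_mat n n" using ws by (auto simp: P_def)
  \<comment> \<open>Gram-Schmidt leaves the columns unnormalised, so the inverse is
    \<open>corthogonal_inv P\<close> instead of the conjugate transpose.\<close>
  have Q: "corthogonal_inv P \<in> carrier_mat n n"
    using P by (auto simp: corthogonal_inv_def mat_of_rows_def)
  have "inverts_mat (corthogonal_inv P) P"
    using corthogonal_inv_result[OF orthogonal_mat_of_cols[OF ws]] by (simp add: P_def)
  then have QP: "corthogonal_inv P * P = 1\<^sub>m n" using Q by (simp add: inverts_mat_def)
  show ?thesis
    using P Q QP mat_mult_left_right_inverse[OF Q P QP]
      corthogonal_col_ev_0[OF _ v _ n hd ws, folded P_def] by blast
qed

section \<open>Deflation by the first basis vector\<close>

definition lower_block :: "'a mat \<Rightarrow> 'a mat" where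
  "lower_block A = mat (dim_row A - 1) (dim_col A - 1) (\<lambda>(i, j). A $$ (Suc i, Suc j))"

lemma lower_block_carrier [simp]:
  "A \<in> carrier_mat (Suc m) (Suc m) \<Longrightarrow> lower_block A \<in> carrier_mat m m"
  by (auto simp: lower_block_def)

lemma lower_block_add:
  assumes "A \<in> carrier_mat (Suc m) (Suc m)" "B \<in> carrier_mat (Suc m) (Suc m)"
  shows "lower_block (A + B) = lower_block A + lower_block B"
  using assms by (intro eq_matI) (auto simp: lower_block_def)

text \<open>Column 0 of \<open>A\<close> vanishes below the corner, so the summand through index 0
  drops out of every lower entry of the product. Conceptually, \<open>A\<close> preserves the span
  of the first basis vector, and \<open>lower_block A\<close> is its action on the quotient.\<close>

lemma lower_block_mult:
  fixes A B :: "'a :: comm_semiring_0 mat"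
  assumes A: "A \<in> carrier_mat (Suc m) (Suc m)" and B: "B \<in> carrier_mat (Suc m) (Suc m)"
    and col: "col A 0 = vec (Suc m) (\<lambda>i. if i = 0 then e else 0)"
  shows "lower_block (A * B) = lower_block A * lower_block B"
proof (rule eq_matI)
  fix i j assume "i < dim_row (lower_block A * lower_block B)"
    "j < dim_col (lower_block A * lower_block B)"
  then have ij: "i < m" "j < m" using A B by (auto simp: lower_block_def)
  have "A $$ (Suc i, 0) = 0"
    using arg_cong[OF col, of "\<lambda>v. v $ Suc i"] ij A by simp
  then show "lower_block (A * B) $$ (i, j) = (lower_block A * lower_block B) $$ (i, j)"
    using A B ij
    by (simp add: lower_block_def scalar_prod_def sum.atLeast0_lessThan_Suc_shift del: sum.op_ivl_Suc)
qed (use A B in \<open>auto simp: lower_block_def\<close>)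

text \<open>\<open>A\<close> is block triangular with the single entry \<open>e\<close> as its upper
  diagonal block, so the characteristic polynomial is the product over the two diagonal
  blocks.\<close>

lemma char_poly_deflate:
  fixes A :: "'a :: idom mat"
  assumes A: "A \<in> carrier_mat (Suc m) (Suc m)"
    and col: "col A 0 = vec (Suc m) (\<lambda>i. if i = 0 then e else 0)"
  shows "char_poly A = [:- e, 1:] * char_poly (lower_block A)"
proof -
  define A1 where "A1 = mat 1 1 (\<lambda>_. e)"
  define A2 where "A2 = mat 1 m (\<lambda>(i, j). A $$ (0, Suc j))"
  have c: "A $$ (i, 0) = (if i = 0 then e else 0)" if "i < Suc m" for i
    using arg_cong[OF col, of "\<lambda>v. v $ i"] that A by simp
  have "A = four_block_mat A1 A2 (0\<^sub>m m 1) (lower_block A)"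
    using A by (intro eq_matI) (auto simp: A1_def A2_def lower_block_def c)
  then have "char_poly A = char_poly (four_block_mat A1 A2 (0\<^sub>m m 1) (lower_block A))" by simp
  also have "\<dots> = char_poly A1 * char_poly (lower_block A)"
    by (rule char_poly_four_block_zeros_col) (use A in \<open>auto simp: A1_def A2_def\<close>)
  also have "char_poly A1 = [:- e, 1:]"
    by (simp add: A1_def char_poly_defs det_def sign_def)
  finally show ?thesis .
qed

text \<open>Induction by deflation at a common eigenvector; the lower blocks commute again because
  \<open>lower_block\<close> is multiplicative here. Keeping both eigenvalues in one list entry
  fixes the pairing, since that entry contributes exactly its sum to \<open>A + B\<close>.\<close>

lemma commuting_char_poly_factorized:
  fixes A B :: "complex mat"
  assumes "A \<in> carrier_mat n n" "B \<in> carrier_mat n n" "A * B = B * A"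
  shows "\<exists>ps. length ps = n \<and>
    char_poly A = (\<Prod>p\<leftarrow>ps. [:- fst p, 1:]) \<and>
    char_poly B = (\<Prod>p\<leftarrow>ps. [:- snd p, 1:]) \<and>
    char_poly (A + B) = (\<Prod>p\<leftarrow>ps. [:- (fst p + snd p), 1:])"
  using assms
proof (induction n arbitrary: A B)
  case 0
  then have "A + B \<in> carrier_mat 0 0" by simp
  with 0 show ?case
    by (simp add: char_poly_defs)
next
  case (Suc m)
  note A = Suc.prems(1) and B = Suc.prems(2)
  from commuting_common_eigenvector[OF A B Suc.prems(3)] obtain v e f
    where v: "v \<in> carrier_vec (Suc m)" "v \<noteq> 0\<^sub>v (Suc m)"
      and e: "A *\<^sub>v v = e \<cdot>\<^sub>v v" and f: "B *\<^sub>v v = f \<cdot>\<^sub>v v" by auto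
  from eigenvector_first_column[OF v] obtain P Q
    where P: "P \<in> carrier_mat (Suc m) (Suc m)" and Q: "Q \<in> carrier_mat (Suc m) (Suc m)"
      and PQ: "P * Q = 1\<^sub>m (Suc m)" and QP: "Q * P = 1\<^sub>m (Suc m)"
      and col: "\<And>X c. X \<in> carrier_mat (Suc m) (Suc m) \<Longrightarrow> X *\<^sub>v v = c \<cdot>\<^sub>v v \<Longrightarrow>
        col (Q * X * P) 0 = vec (Suc m) (\<lambda>i. if i = 0 then c else 0)"
    by blast
  define A' where "A' = Q * A * P"
  define B' where "B' = Q * B * P"
  have A': "A' \<in> carrier_mat (Suc m) (Suc m)" and B': "B' \<in> carrier_mat (Suc m) (Suc m)"
    using A B P Q by (auto simp: A'_def B'_def)
  have sim: "char_poly X = char_poly (Q * X * P)" if X: "X \<in> carrier_mat (Suc m) (Suc m)" for X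
  proof -
    have "similar_mat_wit (Q * X * P) X Q P"
      by (rule similar_mat_witI[of _ _ "Suc m"]) (use X P Q PQ QP in auto)
    then have "similar_mat (Q * X * P) X" by (auto simp: similar_mat_def)
    then show ?thesis by (simp add: char_poly_similar)
  qed
  have conj: "(Q * X * P) * (Q * Y * P) = Q * (X * Y) * P"
    if "X \<in> carrier_mat (Suc m) (Suc m)" "Y \<in> carrier_mat (Suc m) (Suc m)" for X Y
  proof -
    have "(Q * X * P) * (Q * Y * P) = Q * X * (P * Q) * Y * P"
      using that P Q by (simp add: assoc_mult_mat[of _ "Suc m" "Suc m" _ "Suc m" _ "Suc m"])
    also have "\<dots> = Q * (X * Y) * P"
      unfolding PQ using that P Q
      by (simp add: assoc_mult_mat[of _ "Suc m" "Suc m" _ "Suc m" _ "Suc m"])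
    finally show ?thesis .
  qed
  have sum: "Q * (A + B) * P = A' + B'"
    unfolding A'_def B'_def using A B P Q
    by (simp add: mult_add_distrib_mat[of _ "Suc m" "Suc m"] add_mult_distrib_mat[of _ "Suc m" "Suc m"])
  have ef: "(A + B) *\<^sub>v v = (e + f) \<cdot>\<^sub>v v"
    using A B v e f by (simp add: add_mult_distrib_mat_vec[of _ "Suc m" "Suc m"] add_smult_distrib_vec)
  have colA: "col A' 0 = vec (Suc m) (\<lambda>i. if i = 0 then e else 0)"
    and colB: "col B' 0 = vec (Suc m) (\<lambda>i. if i = 0 then f else 0)"
    using col[OF A e] col[OF B f] by (simp_all add: A'_def B'_def)
  have colAB: "col (A' + B') 0 = vec (Suc m) (\<lambda>i. if i = 0 then e + f else 0)"
    using col[OF _ ef] A B by (simp add: sum)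
  have "A' * B' = B' * A'"
    using conj[OF A B] conj[OF B A] Suc.prems(3) by (simp add: A'_def B'_def)
  then have "lower_block A' * lower_block B' = lower_block B' * lower_block A'"
    using lower_block_mult[OF A' B' colA] lower_block_mult[OF B' A' colB] by simp
  from Suc.IH[OF lower_block_carrier[OF A'] lower_block_carrier[OF B'] this] obtain ps
    where ps: "length ps = m"
      "char_poly (lower_block A') = (\<Prod>p\<leftarrow>ps. [:- fst p, 1:])"
      "char_poly (lower_block B') = (\<Prod>p\<leftarrow>ps. [:- snd p, 1:])"
      "char_poly (lower_block A' + lower_block B') = (\<Prod>p\<leftarrow>ps. [:- (fst p + snd p), 1:])"
    by blast
  have "char_poly A = (\<Prod>p\<leftarrow>(e, f) # ps. [:- fst p, 1:])"
    using sim[OF A] char_poly_deflate[OF A' colA] ps by (simp add: A'_def)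
  moreover have "char_poly B = (\<Prod>p\<leftarrow>(e, f) # ps. [:- snd p, 1:])"
    using sim[OF B] char_poly_deflate[OF B' colB] ps by (simp add: B'_def)
  moreover have "char_poly (A + B) = (\<Prod>p\<leftarrow>(e, f) # ps. [:- (fst p + snd p), 1:])"
    using sim[of "A + B"] char_poly_deflate[OF _ colAB] ps A B A' B' lower_block_add[OF A' B']
    by (simp add: sum)
  ultimately show ?case using ps(1) by (intro exI[of _ "(e, f) # ps"]) simp
qed

section \<open>Real symmetric matrices: real roots and descent from the complex numbers\<close>

lemma symmetric_char_poly_root_real:
  fixes A :: "real mat"
  assumes A: "A \<in> carrier_mat n n"
    and sym: "\<And>i j. i < n \<Longrightarrow> j < n \<Longrightarrow> A $$ (i, j) = A $$ (j, i)"
    and root: "poly (char_poly (map_mat complex_of_real A)) z = 0"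
  shows "z \<in> \<real>"
proof -
  let ?A = "map_mat complex_of_real A"
  have cA: "?A \<in> carrier_mat n n" using A by simp
  from root eigenvalue_root_char_poly[OF cA] have "eigenvalue ?A z" by simp
  then obtain v where v: "v \<in> carrier_vec n" "v \<noteq> 0\<^sub>v n" "?A *\<^sub>v v = z \<cdot>\<^sub>v v"
    using A by (auto simp: eigenvalue_def eigenvector_def)
  \<comment> \<open>\<open>q\<close> is the Hermitian form of \<open>A\<close> at \<open>v\<close>.
    The eigenvector equation gives \<open>q = z * r\<close> with \<open>r\<close> the squared norm
    of \<open>v\<close>, while real symmetric entries make \<open>q\<close> self-conjugate. As
    \<open>r\<close> is positive, \<open>z\<close> is real.\<close>
  define q where "q = (\<Sum>i<n. \<Sum>j<n. of_real (A $$ (i, j)) * v $ j * cnj (v $ i))"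
  define r where "r = (\<Sum>i<n. (cmod (v $ i))\<^sup>2)"
  have "(\<Sum>j<n. of_real (A $$ (i, j)) * v $ j) = z * v $ i" if "i < n" for i
    using arg_cong[OF v(3), of "\<lambda>w. w $ i"] that A v(1)
    by (simp add: scalar_prod_def lessThan_atLeast0)
  then have "q = (\<Sum>i<n. z * v $ i * cnj (v $ i))"
    unfolding q_def by (simp add: sum_distrib_right[symmetric])
  also have "\<dots> = z * of_real r"
    unfolding r_def by (simp add: complex_norm_square[symmetric] sum_distrib_left mult.assoc)
  finally have q: "q = z * of_real r" .
  have "cnj q = (\<Sum>i<n. \<Sum>j<n. of_real (A $$ (i, j)) * cnj (v $ j) * v $ i)"
    by (simp add: q_def)
  also have "\<dots> = (\<Sum>j<n. \<Sum>i<n. of_real (A $$ (i, j)) * cnj (v $ j) * v $ i)"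
    by (rule sum.swap)
  also have "\<dots> = q"
    unfolding q_def by (intro sum.cong refl) (use sym in auto)
  finally have cnj: "cnj q = q" .
  obtain i where i: "i < n" "v $ i \<noteq> 0"
  proof (rule ccontr)
    assume "\<not> thesis"
    with that have "v = 0\<^sub>v n" using v(1) by (intro eq_vecI) auto
    with v show False by simp
  qed
  have "r > 0"
    unfolding r_def by (rule sum_pos2[of _ i]) (use i in auto)
  with cnj have "cnj z = z" by (simp add: q)
  then show ?thesis by (simp add: Reals_cnj_iff)
qed

text \<open>The coefficientwise embedding of real polynomials into complex ones is injective and
  commutes with \<open>char_poly\<close>, so a complex factorisation with real roots already holds
  over the reals.\<close>

lemma of_real_char_poly_linear_factors:
  fixes A :: "real mat"
  assumes A: "A \<in> carrier_mat n n"
    and "char_poly (map_mat complex_of_real A) = (\<Prod>x\<leftarrow>xs. [:- complex_of_real x, 1:])"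
  shows "char_poly A = (\<Prod>x\<leftarrow>xs. [:- x, 1:])"
proof -
  interpret poly_hom: map_poly_inj_comm_ring_hom complex_of_real ..
  have "map_poly complex_of_real (char_poly A) = char_poly (map_mat complex_of_real A)"
    by (simp add: of_real_hom.char_poly_hom[OF A])
  also have "\<dots> = map_poly complex_of_real (\<Prod>x\<leftarrow>xs. [:- x, 1:])"
    unfolding assms(2) by (induction xs) (simp_all add: poly_hom.hom_mult del: mult_pCons_left)
  finally show ?thesis
    by (simp add: poly_hom.injectivity)
qed

text \<open>Both components of each complex pair are roots of characteristic polynomials of real
  symmetric matrices, hence real. Their sums are then real too, so all three factorisations descend
  with the pairing intact.\<close>

lemma symmetric_commuting_char_poly_factorized:
  fixes A B :: "real mat"
  assumes A: "A \<in> carrier_mat n n" and B: "B \<in> carrier_mat n n" and comm: "A * B = B * A"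
    and symA: "\<And>i j. i < n \<Longrightarrow> j < n \<Longrightarrow> A $$ (i, j) = A $$ (j, i)"
    and symB: "\<And>i j. i < n \<Longrightarrow> j < n \<Longrightarrow> B $$ (i, j) = B $$ (j, i)"
  shows "\<exists>a b. char_poly A = (\<Prod>i=1..n. [:- a i, 1:]) \<and>
    char_poly B = (\<Prod>i=1..n. [:- b i, 1:]) \<and>
    char_poly (A + B) = (\<Prod>i=1..n. [:- (a i + b i), 1:])"
proof -
  let ?c = "map_mat complex_of_real"
  have "?c A * ?c B = ?c B * ?c A"
    by (simp only: of_real_hom.mat_hom_mult[OF A B, symmetric] of_real_hom.mat_hom_mult[OF B A, symmetric] comm)
  from commuting_char_poly_factorized[OF map_carrier_mat[THEN iffD2, OF A] map_carrier_mat[THEN iffD2, OF B] this]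
  obtain ps where ps: "length ps = n"
    "char_poly (?c A) = (\<Prod>p\<leftarrow>ps. [:- fst p, 1:])"
    "char_poly (?c B) = (\<Prod>p\<leftarrow>ps. [:- snd p, 1:])"
    "char_poly (?c A + ?c B) = (\<Prod>p\<leftarrow>ps. [:- (fst p + snd p), 1:])"
    by blast
  have add: "?c A + ?c B = ?c (A + B)"
    using A B by (intro eq_matI) auto
  have root: "poly (\<Prod>p\<leftarrow>ps. [:- g p, 1:]) (g p) = 0" if "p \<in> set ps"
    for g :: "complex \<times> complex \<Rightarrow> complex" and p
    using that by (auto simp: poly_prod_list prod_list_zero_iff image_iff)
  have re: "fst p = of_real (Re (fst p))" "snd p = of_real (Re (snd p))" if "p \<in> set ps" for p
    using symmetric_char_poly_root_real[OF A symA, of "fst p"] root[OF that, of fst]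
      symmetric_char_poly_root_real[OF B symB, of "snd p"] root[OF that, of snd] ps
    by (simp_all add: of_real_Re)
  have list: "(\<Prod>p\<leftarrow>ps. [:- g p, 1:]) = (\<Prod>x\<leftarrow>map h ps. [:- complex_of_real x, 1:])"
    if "\<And>p. p \<in> set ps \<Longrightarrow> g p = of_real (h p)" for g h
    using that by (auto simp: o_def intro!: arg_cong[of _ _ prod_list])
  \<comment> \<open>List positions start at 0 while the enumeration runs from 1 to \<open>n\<close>,
    hence the shift \<open>i - 1\<close>.\<close>
  have index: "(\<Prod>x\<leftarrow>map h ps. [:- x, 1:]) = (\<Prod>i=1..n. [:- h (ps ! (i - 1)), 1:])"
    for h :: "complex \<times> complex \<Rightarrow> real"
    by (simp add: prod.list_conv_set_nth ps(1) o_def prod.atLeast1_atMost_eq lessThan_atLeast0)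
  have AB: "A + B \<in> carrier_mat n n" using B by simp
  have "char_poly A = (\<Prod>x\<leftarrow>map (\<lambda>p. Re (fst p)) ps. [:- x, 1:])"
    by (rule of_real_char_poly_linear_factors[OF A], unfold ps(2), rule list, rule re)
  moreover have "char_poly B = (\<Prod>x\<leftarrow>map (\<lambda>p. Re (snd p)) ps. [:- x, 1:])"
    by (rule of_real_char_poly_linear_factors[OF B], unfold ps(3), rule list, rule re)
  moreover have "char_poly (A + B) = (\<Prod>x\<leftarrow>map (\<lambda>p. Re (fst p) + Re (snd p)) ps. [:- x, 1:])"
    by (rule of_real_char_poly_linear_factors[OF AB], fold add, unfold ps(4), rule list)
      (unfold of_real_add, rule arg_cong2[of _ _ _ _ "(+)", OF re])
  ultimately show ?thesis
    unfolding index
    by (intro exI[of _ "\<lambda>i. Re (fst (ps ! (i - 1)))"] exI[of _ "\<lambda>i. Re (snd (ps ! (i - 1)))"]) simp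
qed

section \<open>Laplacians of token graphs\<close>

text \<open>Indexing by vertices instead of list positions lets isomorphisms and sums over vertex
  sets be treated without the arbitrary vertex order.\<close>

definition laplacian_entry :: "'a pair_pre_digraph \<Rightarrow> 'a \<Rightarrow> 'a \<Rightarrow> real" where
  "laplacian_entry G u v =
     (if u = v then real (card {w. (u, w) \<in> parcs G}) else 0) - of_bool ((u, v) \<in> parcs G)"

lemma laplacian_matrix_carrier [simp]:
  "laplacian_matrix G \<in> carrier_mat (card (pverts G)) (card (pverts G))"
  unfolding laplacian_matrix_def by (rule minus_carrier_mat) (simp add: adjacency_matrix_def)

lemma pair_graph_finite_pverts: "pair_graph G \<Longrightarrow> finite (pverts G)"
  using pair_fin_digraph.pair_finite_verts pair_digraph.axioms(1) pair_graph.axioms(1) by blast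

lemma laplacian_matrix_index:
  assumes "finite (pverts G)" "i < card (pverts G)" "j < card (pverts G)"
  shows "laplacian_matrix G $$ (i, j) = laplacian_entry G (vertex_list G ! i) (vertex_list G ! j)"
proof -
  have "out_arcs (with_proj G) u = Pair u ` {w. (u, w) \<in> parcs G}" for u
    by (auto simp: out_arcs_def)
  then have "out_degree (with_proj G) u = card {w. (u, w) \<in> parcs G}" for u
    by (simp add: out_degree_def card_image inj_on_def)
  then show ?thesis
    using assms vertex_list[OF assms(1)]
    by (simp add: laplacian_matrix_def degree_matrix_def adjacency_matrix_def laplacian_entry_def
        nth_eq_iff_index_eq)
qed

text \<open>The choice of order depends on the vertex set alone. Graphs on the same vertices
  therefore have matrices with matching indices, which makes their sums and products meaningful
  entry by entry.\<close>

lemma vertex_list_cong: "pverts G = pverts H \<Longrightarrow> vertex_list G = vertex_list H"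
  by (simp add: vertex_list_def)

lemma laplacian_entry_sym:
  assumes "pair_graph G"
  shows "laplacian_entry G u v = laplacian_entry G v u"
proof -
  interpret pair_graph G by fact
  have "(u, v) \<in> parcs G \<longleftrightarrow> (v, u) \<in> parcs G"
    using pair_sym_arcs by (auto simp: symmetric_def dest: symD)
  then show ?thesis by (simp add: laplacian_entry_def)
qed

section \<open>Isomorphism invariance of Laplacian spectra\<close>

definition graph_iso :: "('a \<Rightarrow> 'b) \<Rightarrow> 'a pair_pre_digraph \<Rightarrow> 'b pair_pre_digraph \<Rightarrow> bool" where
  "graph_iso f G H \<longleftrightarrow> bij_betw f (pverts G) (pverts H) \<and>
     (\<forall>u\<in>pverts G. \<forall>v\<in>pverts G. (f u, f v) \<in> parcs H \<longleftrightarrow> (u, v) \<in> parcs G)"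

text \<open>An isomorphism maps the out-neighbours of \<open>u\<close> bijectively onto those of
  \<open>f u\<close>, so degrees agree as well as adjacencies. Applied to automorphisms, this yields
  invariance of a Laplacian under symmetries of its graph.\<close>

lemma laplacian_entry_iso:
  assumes iso: "graph_iso f G H" and G: "pair_graph G" and H: "pair_graph H"
    and uv: "u \<in> pverts G" "v \<in> pverts G"
  shows "laplacian_entry H (f u) (f v) = laplacian_entry G u v"
proof -
  interpret G: pair_graph G by fact
  interpret H: pair_graph H by fact
  have bij: "bij_betw f (pverts G) (pverts H)"
    and arc: "\<And>u v. u \<in> pverts G \<Longrightarrow> v \<in> pverts G \<Longrightarrow> (f u, f v) \<in> parcs H \<longleftrightarrow> (u, v) \<in> parcs G"
    using iso by (auto simp: graph_iso_def)
  have inj: "inj_on f (pverts G)" and im: "f ` pverts G = pverts H"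
    using bij by (auto simp: bij_betw_def)
  have Gin: "w \<in> pverts G" if "(u, w) \<in> parcs G" for w
    using G.in_arcsD2[OF that] by simp
  have Hin: "w \<in> pverts H" if "(f u, w) \<in> parcs H" for w
    using H.in_arcsD2[OF that] by simp
  have "{w. (f u, w) \<in> parcs H} = f ` {w. (u, w) \<in> parcs G}"
    using arc[OF uv(1)] Gin Hin im by fastforce
  moreover have "inj_on f {w. (u, w) \<in> parcs G}"
    using inj Gin by (auto intro: inj_on_subset)
  ultimately have "card {w. (f u, w) \<in> parcs H} = card {w. (u, w) \<in> parcs G}"
    by (simp add: card_image)
  moreover have "f u = f v \<longleftrightarrow> u = v" using inj uv by (auto dest: inj_onD)
  ultimately show ?thesis using arc[OF uv]
    by (cases "u = v") (auto simp: laplacian_entry_def)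
qed

text \<open>\<open>P\<close> is the permutation matrix of \<open>p\<close> and \<open>Q\<close> its
  inverse; reindexing rows and columns by \<open>p\<close> is the conjugation
  \<open>P * A * Q\<close>.\<close>

lemma char_poly_permute:
  fixes A :: "'a :: field mat"
  assumes A: "A \<in> carrier_mat n n" and p: "p permutes {..<n}"
  shows "char_poly (mat n n (\<lambda>(i, j). A $$ (p i, p j))) = char_poly A"
proof -
  define P :: "'a mat" where "P = mat n n (\<lambda>(i, j). of_bool (j = p i))"
  define Q :: "'a mat" where "Q = mat n n (\<lambda>(i, j). of_bool (i = p j))"
  have P: "P \<in> carrier_mat n n" and Q: "Q \<in> carrier_mat n n" by (auto simp: P_def Q_def)
  have pn: "p i < n" if "i < n" for i using permutes_in_image[OF p, of i] that by simp
  have PX: "(P * X) $$ (i, j) = X $$ (p i, j)"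
    if "X \<in> carrier_mat n n" "i < n" "j < n" for X i j
    using that pn[of i]
    by (simp add: P_def scalar_prod_def of_bool_def if_distrib[of "\<lambda>x. x * _"] cong: if_cong)
  have XQ: "(X * Q) $$ (i, j) = X $$ (i, p j)"
    if "X \<in> carrier_mat n n" "i < n" "j < n" for X i j
    using that pn[of j]
    by (simp add: Q_def scalar_prod_def of_bool_def if_distrib[of "\<lambda>x. _ * x"] cong: if_cong)
  have PQ: "P * Q = 1\<^sub>m n"
  proof (rule eq_matI)
    fix i j assume "i < dim_row (1\<^sub>m n)" "j < dim_col (1\<^sub>m n)"
    then show "(P * Q) $$ (i, j) = 1\<^sub>m n $$ (i, j)"
      using PX[OF Q] pn inj_eq[OF permutes_inj[OF p]] by (auto simp: Q_def)
  qed (use P Q in auto)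
  have "mat n n (\<lambda>(i, j). A $$ (p i, p j)) = P * A * Q"
    by (rule eq_matI) (use A P Q PX[OF A] XQ[of "P * A"] pn in auto)
  then have "similar_mat_wit (mat n n (\<lambda>(i, j). A $$ (p i, p j))) A P Q"
    by (intro similar_mat_witI[of _ _ n])
      (use A P Q PQ mat_mult_left_right_inverse[OF P Q PQ] in auto)
  then show ?thesis by (intro char_poly_similar) (auto simp: similar_mat_def)
qed

text \<open>The \<open>f\<close>-image of the vertex list of \<open>G\<close> and the vertex list of
  \<open>H\<close> enumerate the same set without repetition, so they differ by a permutation. The
  two Laplacian matrices then differ by the same reindexing.\<close>

lemma char_poly_laplacian_iso:
  assumes iso: "graph_iso f G H" and G: "pair_graph G" and H: "pair_graph H"
  shows "char_poly (laplacian_matrix G) = char_poly (laplacian_matrix H)"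
proof -
  have fin: "finite (pverts G)" "finite (pverts H)"
    using G H by (auto intro: pair_graph_finite_pverts)
  have bij: "bij_betw f (pverts G) (pverts H)" using iso by (simp add: graph_iso_def)
  define n where "n = card (pverts H)"
  have n: "card (pverts G) = n" using bij_betw_same_card[OF bij] by (simp add: n_def)
  note vG = vertex_list[OF fin(1), unfolded n] and vH = vertex_list[OF fin(2), folded n_def]
  have "distinct (map f (vertex_list G))"
    using vG bij by (simp add: distinct_map bij_betw_def)
  moreover have "set (map f (vertex_list G)) = set (vertex_list H)"
    using vG vH bij by (simp add: bij_betw_def)
  ultimately have "mset (map f (vertex_list G)) = mset (vertex_list H)"
    using vH by (metis set_eq_iff_mset_eq_distinct)
  then obtain p where p: "p permutes {..<length (vertex_list H)}"
    "permute_list p (vertex_list H) = map f (vertex_list G)"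
    by (rule mset_eq_permutation)
  have nth: "vertex_list H ! p i = f (vertex_list G ! i)" if "i < n" for i
    using arg_cong[OF p(2), of "\<lambda>xs. xs ! i"] that vG vH p(1)
    by (simp add: permute_list_nth)
  have pn: "p i < n" if "i < n" for i
    using permutes_in_image[OF p(1), of i] that vH by simp
  have inG: "vertex_list G ! i \<in> pverts G" if "i < n" for i
    using vG that nth_mem by metis
  have "laplacian_matrix G = mat n n (\<lambda>(i, j). laplacian_matrix H $$ (p i, p j))"
  proof (rule eq_matI)
    fix i j
    assume "i < dim_row (mat n n (\<lambda>(i, j). laplacian_matrix H $$ (p i, p j)))"
      "j < dim_col (mat n n (\<lambda>(i, j). laplacian_matrix H $$ (p i, p j)))"
    then have ij: "i < n" "j < n" by auto
    then show "laplacian_matrix G $$ (i, j) =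
      mat n n (\<lambda>(i, j). laplacian_matrix H $$ (p i, p j)) $$ (i, j)"
      using laplacian_matrix_index[OF fin(1), unfolded n, OF ij]
        laplacian_matrix_index[OF fin(2), folded n_def, OF pn[OF ij(1)] pn[OF ij(2)]]
        laplacian_entry_iso[OF iso G H inG[OF ij(1)] inG[OF ij(2)]]
      by (simp add: nth)
  qed (use laplacian_matrix_carrier[of G, unfolded n] in auto)
  then show ?thesis
    using char_poly_permute[OF laplacian_matrix_carrier[of H, folded n_def], of p] p(1) vH by simp
qed

section \<open>Token graphs of isomorphic graphs\<close>

lemma pverts_token_graph: "pverts (token_graph k G) = {A. A \<subseteq> pverts G \<and> card A = k}"
  by (simp add: token_graph_def Let_def)

lemma parcs_token_graph:
  "(A, B) \<in> parcs (token_graph k G) \<longleftrightarrow>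
     A \<in> pverts (token_graph k G) \<and> B \<in> pverts (token_graph k G) \<and>
     (\<exists>a b. a \<in> A \<and> b \<in> B \<and> (A - B) \<union> (B - A) = {a, b} \<and> (a, b) \<in> parcs G)"
  by (auto simp: token_graph_def Let_def)

text \<open>Injectivity of \<open>f\<close> makes images preserve cardinalities and commute with
  symmetric differences, so token moves along arcs of \<open>G\<close> and of \<open>H\<close>
  correspond.\<close>

lemma graph_iso_token_graph:
  assumes iso: "graph_iso f G H"
  shows "graph_iso ((`) f) (token_graph k G) (token_graph k H)"
proof -
  have bij: "bij_betw f (pverts G) (pverts H)"
    and arc: "\<And>u v. u \<in> pverts G \<Longrightarrow> v \<in> pverts G \<Longrightarrow> (f u, f v) \<in> parcs H \<longleftrightarrow> (u, v) \<in> parcs G"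
    using iso by (auto simp: graph_iso_def)
  have inj: "inj_on f (pverts G)" using bij by (simp add: bij_betw_def)
  have bij': "bij_betw ((`) f) (pverts (token_graph k G)) (pverts (token_graph k H))"
  proof -
    have card: "card (f ` A) = card A" if "A \<subseteq> pverts G" for A
      using inj that by (meson card_image inj_on_subset)
    have "inj_on ((`) f) (pverts (token_graph k G))"
      by (rule inj_on_subset[OF inj_on_image_Pow[OF inj]]) (auto simp: pverts_token_graph)
    moreover have "(`) f ` pverts (token_graph k G) = pverts (token_graph k H)"
    proof (intro equalityI subsetI)
      fix B assume "B \<in> (`) f ` pverts (token_graph k G)"
      then show "B \<in> pverts (token_graph k H)"
        using bij card by (auto simp: pverts_token_graph bij_betw_def)
    next
      fix B assume B: "B \<in> pverts (token_graph k H)"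
      then have "B \<subseteq> f ` pverts G" using bij by (simp add: pverts_token_graph bij_betw_def)
      then obtain A where "A \<subseteq> pverts G" "B = f ` A" by (rule subset_imageE)
      then show "B \<in> (`) f ` pverts (token_graph k G)"
        using B card by (auto simp: pverts_token_graph)
    qed
    ultimately show ?thesis by (simp add: bij_betw_def)
  qed
  have "(f ` A, f ` B) \<in> parcs (token_graph k H) \<longleftrightarrow> (A, B) \<in> parcs (token_graph k G)"
    if A: "A \<in> pverts (token_graph k G)" and B: "B \<in> pverts (token_graph k G)" for A B
  proof -
    have sub: "A \<subseteq> pverts G" "B \<subseteq> pverts G" using A B by (auto simp: pverts_token_graph)
    have in': "f ` A \<in> pverts (token_graph k H)" "f ` B \<in> pverts (token_graph k H)"
      using bij' A B by (auto simp: bij_betw_def)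
    have diff: "(f ` A - f ` B) \<union> (f ` B - f ` A) = f ` ((A - B) \<union> (B - A))"
      using inj sub by (auto dest: inj_onD)
    have eq: "(f ` A - f ` B) \<union> (f ` B - f ` A) = {f a, f b} \<longleftrightarrow> (A - B) \<union> (B - A) = {a, b}"
      if "a \<in> A" "b \<in> B" for a b
    proof -
      have "{f a, f b} = f ` {a, b}" by simp
      then show ?thesis
        unfolding diff using inj_on_image_eq_iff[OF inj, of "(A - B) \<union> (B - A)" "{a, b}"] sub that
        by auto
    qed
    have arc': "(f a, f b) \<in> parcs H \<longleftrightarrow> (a, b) \<in> parcs G" if "a \<in> A" "b \<in> B" for a b
      using arc sub that by blast
    have "(\<exists>a b. a \<in> f ` A \<and> b \<in> f ` B \<and> (f ` A - f ` B) \<union> (f ` B - f ` A) = {a, b} \<and> (a, b) \<in> parcs H)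
      \<longleftrightarrow> (\<exists>a\<in>A. \<exists>b\<in>B. (f ` A - f ` B) \<union> (f ` B - f ` A) = {f a, f b} \<and> (f a, f b) \<in> parcs H)"
      by blast
    also have "\<dots> \<longleftrightarrow> (\<exists>a\<in>A. \<exists>b\<in>B. (A - B) \<union> (B - A) = {a, b} \<and> (a, b) \<in> parcs G)"
      using eq arc' by (intro bex_cong refl) auto
    also have "\<dots> \<longleftrightarrow> (\<exists>a b. a \<in> A \<and> b \<in> B \<and> (A - B) \<union> (B - A) = {a, b} \<and> (a, b) \<in> parcs G)"
      by blast
    finally show ?thesis
      unfolding parcs_token_graph by (simp only: A B in' simp_thms)
  qed
  with bij' show ?thesis by (simp add: graph_iso_def)
qed

section \<open>Token moves as transpositions of vertices\<close>

lemma transpose_image_eq_if: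
  "transpose a b ` X =
     (if a \<in> X \<longleftrightarrow> b \<in> X then X else if a \<in> X then insert b (X - {a}) else insert a (X - {b}))"
  by (rule Set.set_eqI) (auto simp: in_transpose_image_iff transpose_def)

text \<open>A transposition changes \<open>X\<close> only if exactly one of \<open>a\<close>,
  \<open>b\<close> carries a token, and then it moves that token to the other. The token may sit at
  either end, whence the two alternatives.\<close>

lemma transpose_image_eq_iff:
  assumes "X \<noteq> Y"
  shows "transpose a b ` X = Y \<longleftrightarrow> X - Y = {a} \<and> Y - X = {b} \<or> X - Y = {b} \<and> Y - X = {a}"
proof -
  have "Y = insert b (X - {a})" if "X - Y = {a}" "Y - X = {b}" for a b
    using that by blast
  moreover have "X - insert b (X - {a}) = {a}" "insert b (X - {a}) - X = {b}" if "a \<in> X" "b \<notin> X" for a b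
    using that by auto
  ultimately show ?thesis
    unfolding transpose_image_eq_if using assms by (metis Diff_iff insertI1)
qed

lemma transpose_image_token:
  assumes "a \<in> pverts G" "b \<in> pverts G" "X \<in> pverts (token_graph k G)"
  shows "transpose a b ` X \<in> pverts (token_graph k G)"
proof -
  have "card (transpose a b ` X) = card X" by (intro card_image inj_on_subset[OF inj_transpose]) simp
  moreover have "transpose a b ` X \<subseteq> pverts G"
    using assms by (auto simp: pverts_token_graph transpose_def)
  ultimately show ?thesis using assms(3) by (simp add: pverts_token_graph)
qed

text \<open>Transpositions are involutions. Moving one to the other side isolates the summation
  variable, so that a sum of such indicators over all \<open>X\<close> picks out a single
  term.\<close>

lemma transpose_image_swap: "transpose a b ` X = Y \<longleftrightarrow> X = transpose a b ` Y"
  by (auto simp: image_image)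

text \<open>The factor 2 appears because the edge \<open>{a, b}\<close> is the two arcs \<open>(a, b)\<close> and \<open>(b, a)\<close>.\<close>

lemma token_graph_arc_count:
  assumes G: "pair_graph G" and XY: "X \<in> pverts (token_graph k G)" "Y \<in> pverts (token_graph k G)"
    and neq: "X \<noteq> Y"
  shows "2 * of_bool ((X, Y) \<in> parcs (token_graph k G)) =
    (\<Sum>(a, b)\<in>parcs G. of_bool (transpose a b ` X = Y) :: real)"
proof -
  interpret pair_graph G by fact
  have sym: "(u, v) \<in> parcs G \<longleftrightarrow> (v, u) \<in> parcs G" for u v
    using pair_sym_arcs by (auto simp: symmetric_def dest: symD)
  have irr: "(u, u) \<notin> parcs G" for u
    using pair_no_loops[of "(u, u)"] by auto
  have fin: "finite (parcs G)" by (rule pair_finite_arcs)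
  define S where "S = {(a, b) \<in> parcs G. transpose a b ` X = Y}"
  have arc: "(X, Y) \<in> parcs (token_graph k G) \<longleftrightarrow>
    (\<exists>a b. X - Y = {a} \<and> Y - X = {b} \<and> (a, b) \<in> parcs G)"
  proof
    assume "(X, Y) \<in> parcs (token_graph k G)"
    then obtain a b where ab: "a \<in> X" "b \<in> Y" "(X - Y) \<union> (Y - X) = {a, b}" "(a, b) \<in> parcs G"
      by (auto simp: parcs_token_graph)
    then have "a \<noteq> b" using irr by auto
    with ab have "X - Y = {a}" "Y - X = {b}" by auto
    with ab show "\<exists>a b. X - Y = {a} \<and> Y - X = {b} \<and> (a, b) \<in> parcs G" by blast
  next
    assume "\<exists>a b. X - Y = {a} \<and> Y - X = {b} \<and> (a, b) \<in> parcs G"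
    then obtain a b where ab: "X - Y = {a}" "Y - X = {b}" "(a, b) \<in> parcs G" by blast
    then have "(X - Y) \<union> (Y - X) = {a, b}" by (simp add: insert_commute)
    with ab XY show "(X, Y) \<in> parcs (token_graph k G)"
      unfolding parcs_token_graph by blast
  qed
  have "(\<Sum>(a, b)\<in>parcs G. of_bool (transpose a b ` X = Y) :: real) = card S"
    using fin by (simp add: S_def case_prod_unfold Int_def)
  also have "\<dots> = 2 * of_bool ((X, Y) \<in> parcs (token_graph k G))"
  proof (cases "(X, Y) \<in> parcs (token_graph k G)")
    case True
    then obtain a b where ab: "X - Y = {a}" "Y - X = {b}" "(a, b) \<in> parcs G"
      using arc by blast
    have "S = {(a, b), (b, a)}"
      using ab sym[of a b] by (auto simp: S_def transpose_image_eq_iff[OF neq])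
    moreover have "a \<noteq> b" using ab irr by auto
    ultimately show ?thesis using True by simp
  next
    case False
    have "S = {}"
      using False sym unfolding arc S_def by (auto simp: transpose_image_eq_iff[OF neq])
    with False show ?thesis by simp
  qed
  finally show ?thesis by simp
qed

text \<open>This is the edge-transposition formula for the Laplacian, doubled because it runs over
  arcs. Off the diagonal it is the arc count. On the diagonal, each arc sends \<open>X\<close> to
  exactly one \<open>k\<close>-set, which contributes to the degree unless it is \<open>X\<close>
  itself.\<close>

lemma token_graph_laplacian_entry:
  assumes G: "pair_graph G" and XY: "X \<in> pverts (token_graph k G)" "Y \<in> pverts (token_graph k G)"
  shows "2 * laplacian_entry (token_graph k G) X Y =
    (\<Sum>(a, b)\<in>parcs G. of_bool (X = Y) - of_bool (transpose a b ` X = Y))"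
proof -
  interpret pair_graph G by fact
  interpret T: pair_graph "token_graph k G" by (rule pair_graph_token[OF G])
  let ?W = "pverts (token_graph k G)"
  have irr: "(X, X) \<notin> parcs (token_graph k G)"
    using T.pair_no_loops[of "(X, X)"] by auto
  show ?thesis
  proof (cases "X = Y")
    case False
    then show ?thesis
      using token_graph_arc_count[OF G XY False]
      by (simp add: laplacian_entry_def case_prod_unfold sum_negf)
  next
    case True
    \<comment> \<open>Leaving out \<open>X\<close> loses no neighbour, as there are no loops, and
      makes the arc count for distinct sets applicable to every remaining \<open>Z\<close>.\<close>
    have "(?W - {X}) \<inter> {Z. (X, Z) \<in> parcs (token_graph k G)} = {Z. (X, Z) \<in> parcs (token_graph k G)}"
      using irr by (auto simp: parcs_token_graph)
    then have "(\<Sum>Z\<in>?W - {X}. of_bool ((X, Z) \<in> parcs (token_graph k G))) =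
      real (card {Z. (X, Z) \<in> parcs (token_graph k G)})"
      using T.pair_finite_verts by simp
    then have "2 * laplacian_entry (token_graph k G) X Y =
      (\<Sum>Z\<in>?W - {X}. 2 * of_bool ((X, Z) \<in> parcs (token_graph k G)))"
      using True irr by (simp only: laplacian_entry_def sum_distrib_left[symmetric]) simp
    also have "\<dots> = (\<Sum>Z\<in>?W - {X}. \<Sum>(a, b)\<in>parcs G. of_bool (transpose a b ` X = Z))"
      by (rule sum.cong[OF refl], rule token_graph_arc_count[OF G XY(1)]) auto
    also have "\<dots> = (\<Sum>e\<in>parcs G. \<Sum>Z\<in>?W - {X}. of_bool (transpose (fst e) (snd e) ` X = Z))"
      unfolding case_prod_unfold by (rule sum.swap)
    also have "\<dots> = (\<Sum>e\<in>parcs G. 1 - of_bool (transpose (fst e) (snd e) ` X = X))"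
    proof (rule sum.cong[OF refl])
      fix e assume "e \<in> parcs G"
      then have "transpose (fst e) (snd e) ` X \<in> ?W"
        using transpose_image_token XY(1) in_arcsD1 in_arcsD2 by (metis prod.collapse)
      then show "(\<Sum>Z\<in>?W - {X}. of_bool (transpose (fst e) (snd e) ` X = Z)) =
        (1 - of_bool (transpose (fst e) (snd e) ` X = X) :: real)"
        using T.pair_finite_verts by (simp add: of_bool_def)
    qed
    finally show ?thesis using True by (simp add: case_prod_unfold)
  qed
qed

text \<open>For an edge transposition \<open>t\<close>, invariance at the pair \<open>X\<close>,
  \<open>t Y\<close> gives \<open>E X (t Y) = E (t X) Y\<close>, because \<open>t\<close> is an
  involution. So \<open>E\<close> commutes with the contribution of each arc to the Laplacian, and
  hence with their sum.\<close>

lemma token_graph_laplacian_commute: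
  fixes E :: "'a set \<Rightarrow> 'a set \<Rightarrow> real"
  assumes G: "pair_graph G" and XY: "X \<in> pverts (token_graph k G)" "Y \<in> pverts (token_graph k G)"
    and inv: "\<And>a b X Y. a \<in> pverts G \<Longrightarrow> b \<in> pverts G \<Longrightarrow> X \<in> pverts (token_graph k G) \<Longrightarrow>
      Y \<in> pverts (token_graph k G) \<Longrightarrow> E (transpose a b ` X) (transpose a b ` Y) = E X Y"
  shows "(\<Sum>Z\<in>pverts (token_graph k G). E X Z * laplacian_entry (token_graph k G) Z Y) =
    (\<Sum>Z\<in>pverts (token_graph k G). laplacian_entry (token_graph k G) X Z * E Z Y)"
proof -
  interpret pair_graph G by fact
  interpret T: pair_graph "token_graph k G" by (rule pair_graph_token[OF G])
  let ?W = "pverts (token_graph k G)" and ?L = "laplacian_entry (token_graph k G)"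
  let ?t = "\<lambda>e. transpose (fst e) (snd e)"
  have tW: "?t e ` Z \<in> ?W" if "e \<in> parcs G" "Z \<in> ?W" for e Z
    using that transpose_image_token in_arcsD1 in_arcsD2 by (metis prod.collapse)
  have pick: "(\<Sum>Z\<in>?W. f Z * of_bool (Z = U)) = f U" if "U \<in> ?W" for f :: "_ \<Rightarrow> real" and U
    using that T.pair_finite_verts by (simp add: of_bool_def if_distrib[of "\<lambda>x. _ * x"] cong: if_cong)
  have L1: "2 * ?L Z Y = (\<Sum>e\<in>parcs G. of_bool (Z = Y) - of_bool (Z = ?t e ` Y))" if "Z \<in> ?W" for Z
    using token_graph_laplacian_entry[OF G that XY(2)]
    by (simp add: case_prod_unfold transpose_image_swap)
  have L2: "2 * ?L X Z = (\<Sum>e\<in>parcs G. of_bool (Z = X) - of_bool (Z = ?t e ` X))" if "Z \<in> ?W" for Z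
    using token_graph_laplacian_entry[OF G XY(1) that]
    by (simp add: case_prod_unfold eq_commute[of _ Z])
  have "2 * (\<Sum>Z\<in>?W. E X Z * ?L Z Y) = (\<Sum>Z\<in>?W. E X Z * (2 * ?L Z Y))"
    by (simp add: sum_distrib_left mult_ac)
  also have "\<dots> = (\<Sum>Z\<in>?W. \<Sum>e\<in>parcs G. E X Z * of_bool (Z = Y) - E X Z * of_bool (Z = ?t e ` Y))"
    by (simp add: L1 sum_distrib_left right_diff_distrib)
  also have "\<dots> = (\<Sum>e\<in>parcs G. \<Sum>Z\<in>?W. E X Z * of_bool (Z = Y) - E X Z * of_bool (Z = ?t e ` Y))"
    by (rule sum.swap)
  also have "\<dots> = (\<Sum>e\<in>parcs G. E X Y - E X (?t e ` Y))"
    by (rule sum.cong[OF refl]) (simp only: sum_subtractf pick XY tW)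
  also have "\<dots> = (\<Sum>e\<in>parcs G. E X Y - E (?t e ` X) Y)"
  proof (rule sum.cong[OF refl])
    fix e assume e: "e \<in> parcs G"
    have "E (?t e ` X) (?t e ` ?t e ` Y) = E X (?t e ` Y)"
      using inv[OF _ _ XY(1) tW[OF e XY(2)], of "fst e" "snd e"] e in_arcsD1 in_arcsD2
      by (metis prod.collapse)
    then show "E X Y - E X (?t e ` Y) = E X Y - E (?t e ` X) Y"
      by (simp add: image_image)
  qed
  also have "\<dots> = (\<Sum>e\<in>parcs G. \<Sum>Z\<in>?W. E Z Y * of_bool (Z = X) - E Z Y * of_bool (Z = ?t e ` X))"
    by (rule sum.cong[OF refl]) (simp only: sum_subtractf pick XY tW)
  also have "\<dots> = (\<Sum>Z\<in>?W. \<Sum>e\<in>parcs G. E Z Y * of_bool (Z = X) - E Z Y * of_bool (Z = ?t e ` X))"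
    by (rule sum.swap)
  also have "\<dots> = (\<Sum>Z\<in>?W. E Z Y * (2 * ?L X Z))"
    by (simp add: L2 sum_distrib_left right_diff_distrib)
  also have "\<dots> = 2 * (\<Sum>Z\<in>?W. ?L X Z * E Z Y)"
    by (simp add: sum_distrib_left mult_ac)
  finally show ?thesis by simp
qed

section \<open>The complete graph on the vertices of the given graph\<close>

definition complete_graph_on :: "'a set \<Rightarrow> 'a pair_pre_digraph" where
  "complete_graph_on V = \<lparr> pverts = V, parcs = {(u, v). u \<in> V \<and> v \<in> V \<and> u \<noteq> v} \<rparr>"

lemma pair_graph_complete_graph_on: "finite V \<Longrightarrow> pair_graph (complete_graph_on V)"
  by (rule pair_graphI) (auto simp: complete_graph_on_def)

text \<open>For \<open>W = V\<close> every permutation of \<open>V\<close> becomes an automorphism;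
  for \<open>W = {1..n}\<close> the result leads to the Johnson graph. Working on the vertices of
  \<open>G\<close> first keeps the matrix indices of the token graphs aligned.\<close>

lemma graph_iso_complete_graph_on:
  "bij_betw f V W \<Longrightarrow> graph_iso f (complete_graph_on V) (complete_graph_on W)"
  by (auto simp: graph_iso_def complete_graph_on_def bij_betw_def dest: inj_onD)

lemma index_mult_mat_sum:
  assumes "A \<in> carrier_mat n n" "B \<in> carrier_mat n n" "i < n" "j < n"
  shows "(A * B) $$ (i, j) = (\<Sum>l = 0..<n. A $$ (i, l) * B $$ (l, j))"
  using assms by (simp add: scalar_prod_def)

lemma sum_over_vertex_list:
  assumes "finite (pverts G)"
  shows "(\<Sum>i = 0..<card (pverts G). f (vertex_list G ! i)) = (\<Sum>v\<in>pverts G. f v)"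
  using sum.reindex_bij_betw[OF bij_betw_nth[OF vertex_list(1)[OF assms] refl refl], of f]
  by (simp add: vertex_list[OF assms] lessThan_atLeast0)

text \<open>The arcs of the complete graph split disjointly into those of \<open>G\<close> and of
  its complement, and the formula for Laplacian entries is a sum over arcs. A common vertex order
  turns this into an identity of matrices.\<close>

lemma token_graph_laplacian_add_complement:
  assumes G: "pair_graph G"
  shows "laplacian_matrix (token_graph k G) + laplacian_matrix (token_graph k (graph_complement G)) =
    laplacian_matrix (token_graph k (complete_graph_on (pverts G)))"
proof -
  interpret pair_graph G by fact
  let ?G' = "graph_complement G" and ?K = "complete_graph_on (pverts G)"
  have G': "pair_graph ?G'" by (rule pair_graph_complement[OF G])
  interpret C: pair_graph ?G' by (rule G')
  have K: "pair_graph ?K" by (rule pair_graph_complete_graph_on[OF pair_finite_verts])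
  have V: "pverts (token_graph k ?G') = pverts (token_graph k G)"
    "pverts (token_graph k ?K) = pverts (token_graph k G)"
    by (simp_all add: pverts_token_graph graph_complement_def complete_graph_on_def)
  note vl = vertex_list_cong[OF V(1)] vertex_list_cong[OF V(2)]
  have fin: "finite (pverts (token_graph k G))"
    by (simp add: pverts_token_graph pair_finite_verts)
  have parcs: "parcs ?K = parcs G \<union> parcs ?G'" "parcs G \<inter> parcs ?G' = {}"
    using in_arcsD1 in_arcsD2 pair_no_loops[of "(u, u)" for u]
    by (auto simp: complete_graph_on_def graph_complement_def)
  have fin_arcs: "finite (parcs G)" "finite (parcs ?G')"
    using pair_finite_arcs C.pair_finite_arcs by simp_all
  have entry: "laplacian_entry (token_graph k G) X Y + laplacian_entry (token_graph k ?G') X Y =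
    laplacian_entry (token_graph k ?K) X Y"
    if "X \<in> pverts (token_graph k G)" "Y \<in> pverts (token_graph k G)" for X Y
  proof -
    have "2 * laplacian_entry (token_graph k ?K) X Y =
      2 * laplacian_entry (token_graph k G) X Y + 2 * laplacian_entry (token_graph k ?G') X Y"
      using that
      by (simp only: token_graph_laplacian_entry[OF G] token_graph_laplacian_entry[OF G']
          token_graph_laplacian_entry[OF K] V parcs(1) sum.union_disjoint[OF fin_arcs parcs(2)])
    then show ?thesis by simp
  qed
  have mem: "vertex_list (token_graph k G) ! i \<in> pverts (token_graph k G)"
    if "i < card (pverts (token_graph k G))" for i
    using vertex_list[OF fin] that nth_mem by metis
  show ?thesis
    by (rule eq_matI)
      (use laplacian_matrix_carrier[of "token_graph k G"] laplacian_matrix_carrier[of "token_graph k ?G'"]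
        laplacian_matrix_carrier[of "token_graph k ?K"] in
        \<open>auto simp: V vl fin laplacian_matrix_index entry mem\<close>)
qed

text \<open>Vertex transpositions are automorphisms of the complete graph and induce automorphisms
  of its token graph. Its Laplacian entries thus form an invariant kernel \<open>E\<close> as
  required for commutation.\<close>

lemma token_graph_laplacian_commute_complete:
  assumes G: "pair_graph G"
  shows "laplacian_matrix (token_graph k (complete_graph_on (pverts G))) * laplacian_matrix (token_graph k G) =
    laplacian_matrix (token_graph k G) * laplacian_matrix (token_graph k (complete_graph_on (pverts G)))"
    (is "?LK * ?LG = _")
proof -
  interpret pair_graph G by fact
  let ?K = "complete_graph_on (pverts G)" and ?T = "token_graph k G"
  let ?E = "laplacian_entry (token_graph k ?K)"
  have K: "pair_graph ?K" by (rule pair_graph_complete_graph_on[OF pair_finite_verts])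
  have V: "pverts (token_graph k ?K) = pverts ?T"
    by (simp add: pverts_token_graph complete_graph_on_def)
  note vl = vertex_list_cong[OF V]
  have fin: "finite (pverts ?T)"
    by (simp add: pverts_token_graph pair_finite_verts)
  have inv: "?E (transpose a b ` X) (transpose a b ` Y) = ?E X Y"
    if "a \<in> pverts G" "b \<in> pverts G" "X \<in> pverts ?T" "Y \<in> pverts ?T" for a b X Y
  proof -
    have "bij_betw (transpose a b) (pverts G) (pverts G)"
      using permutes_imp_bij[OF permutes_swap_id[OF that(1,2)]] .
    from graph_iso_token_graph[OF graph_iso_complete_graph_on[OF this]]
    have "graph_iso ((`) (transpose a b)) (token_graph k ?K) (token_graph k ?K)" .
    from laplacian_entry_iso[OF this pair_graph_token[OF K] pair_graph_token[OF K]]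
    show ?thesis using that V by simp
  qed
  have mem: "vertex_list ?T ! i \<in> pverts ?T" if "i < card (pverts ?T)" for i
    using vertex_list[OF fin] that nth_mem by metis
  have C: "?LG \<in> carrier_mat (card (pverts ?T)) (card (pverts ?T))"
    "?LK \<in> carrier_mat (card (pverts ?T)) (card (pverts ?T))"
    using laplacian_matrix_carrier[of ?T] laplacian_matrix_carrier[of "token_graph k ?K"]
    by (simp_all only: V)
  have idx: "?LG $$ (i, j) = laplacian_entry ?T (vertex_list ?T ! i) (vertex_list ?T ! j)"
    "?LK $$ (i, j) = ?E (vertex_list ?T ! i) (vertex_list ?T ! j)"
    if "i < card (pverts ?T)" "j < card (pverts ?T)" for i j
    using that laplacian_matrix_index[of ?T] laplacian_matrix_index[of "token_graph k ?K"] fin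
    by (simp_all only: V vl)
  show ?thesis
  proof (rule eq_matI)
    fix i j assume "i < dim_row (?LG * ?LK)" "j < dim_col (?LG * ?LK)"
    then have ij: "i < card (pverts ?T)" "j < card (pverts ?T)" using C by auto
    have "(?LK * ?LG) $$ (i, j) = (\<Sum>l = 0..<card (pverts ?T).
      ?E (vertex_list ?T ! i) (vertex_list ?T ! l) * laplacian_entry ?T (vertex_list ?T ! l) (vertex_list ?T ! j))"
      by (simp add: index_mult_mat_sum[OF C(2,1) ij] idx ij)
    also have "\<dots> = (\<Sum>Z\<in>pverts ?T. ?E (vertex_list ?T ! i) Z * laplacian_entry ?T Z (vertex_list ?T ! j))"
      by (rule sum_over_vertex_list[OF fin])
    also have "\<dots> = (\<Sum>Z\<in>pverts ?T. laplacian_entry ?T (vertex_list ?T ! i) Z * ?E Z (vertex_list ?T ! j))"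
      by (rule token_graph_laplacian_commute[where E = ?E, OF G mem[OF ij(1)] mem[OF ij(2)] inv])
    also have "\<dots> = (\<Sum>l = 0..<card (pverts ?T).
      laplacian_entry ?T (vertex_list ?T ! i) (vertex_list ?T ! l) * ?E (vertex_list ?T ! l) (vertex_list ?T ! j))"
      by (rule sum_over_vertex_list[OF fin, symmetric])
    also have "\<dots> = (?LG * ?LK) $$ (i, j)"
      by (simp add: index_mult_mat_sum[OF C(1,2) ij] idx ij)
    finally show "(?LK * ?LG) $$ (i, j) = (?LG * ?LK) $$ (i, j)" .
  qed (use carrier_matD[OF C(1)] carrier_matD[OF C(2)] in auto)
qed

section \<open>Pairing the Laplacian eigenvalues of the two token graphs\<close>

theorem theorem6p2:
  fixes G :: "'a pair_pre_digraph" and n k :: nat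
  assumes "pair_graph G"
    and "n = card (pverts G)"
    and "1 \<le> k" and "k < n - 1"
  shows "\<exists>(ev :: nat \<Rightarrow> real) (ev' :: nat \<Rightarrow> real) (\<theta> :: nat \<Rightarrow> real).
           enumerates_laplacian_eigenvalues (token_graph k G) (n choose k) ev \<and>
           enumerates_laplacian_eigenvalues (token_graph k (graph_complement G)) (n choose k) ev' \<and>
           enumerates_laplacian_eigenvalues (johnson_graph n k) (n choose k) \<theta> \<and>
           (\<forall>i\<in>{1..n choose k}. ev i + ev' i = \<theta> i)"
proof -
  note G = assms(1)
  interpret pair_graph G by fact
  let ?G' = "graph_complement G" and ?K = "complete_graph_on (pverts G)"
  let ?L = "laplacian_matrix (token_graph k G)"
  let ?L' = "laplacian_matrix (token_graph k ?G')"
  have G': "pair_graph ?G'" by (rule pair_graph_complement[OF G])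
  have "pverts ?G' = pverts G" by (simp add: graph_complement_def)
  then have card: "card (pverts (token_graph k G)) = n choose k"
    "card (pverts (token_graph k ?G')) = n choose k"
    using card_pverts_token_graph[of G k] card_pverts_token_graph[of ?G' k] assms(2)
    by (simp_all add: pair_finite_verts)
  have C: "?L \<in> carrier_mat (n choose k) (n choose k)" "?L' \<in> carrier_mat (n choose k) (n choose k)"
    using laplacian_matrix_carrier[of "token_graph k G"] laplacian_matrix_carrier[of "token_graph k ?G'"]
    by (simp_all only: card)
  have sym: "laplacian_matrix (token_graph k H) $$ (i, j) = laplacian_matrix (token_graph k H) $$ (j, i)"
    if H: "pair_graph H" "card (pverts (token_graph k H)) = n choose k"
      and "i < n choose k" "j < n choose k" for H :: "'a pair_pre_digraph" and i j
  proof -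
    have "finite (pverts (token_graph k H))"
      by (rule pair_graph_finite_pverts[OF pair_graph_token[OF H(1)]])
    then show ?thesis
      using that laplacian_entry_sym[OF pair_graph_token[OF H(1)]]
      by (simp add: laplacian_matrix_index)
  qed
  \<comment> \<open>Commuting with the sum suffices: after expansion the common term
    \<open>?L * ?L\<close> cancels, which leaves commutation of \<open>?L\<close> with
    \<open>?L'\<close>.\<close>
  have "(?L + ?L') * ?L = ?L * (?L + ?L')"
    unfolding token_graph_laplacian_add_complement[OF G]
    by (rule token_graph_laplacian_commute_complete[OF G])
  then have eq: "?L * ?L + ?L' * ?L = ?L * ?L + ?L * ?L'"
    using C by (simp add: add_mult_distrib_mat[OF C C(1)] mult_add_distrib_mat[OF C(1) C])
  have comm: "?L * ?L' = ?L' * ?L"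
  proof (rule eq_matI)
    fix i j assume "i < dim_row (?L' * ?L)" "j < dim_col (?L' * ?L)"
    then have "i < dim_row ?L" "j < dim_col ?L" "i < dim_row ?L'" "j < dim_col ?L'"
      using carrier_matD[OF C(1)] carrier_matD[OF C(2)] by auto
    then show "(?L * ?L') $$ (i, j) = (?L' * ?L) $$ (i, j)"
      using arg_cong[OF eq, of "\<lambda>M. M $$ (i, j)"] by simp
  qed (use carrier_matD[OF C(1)] carrier_matD[OF C(2)] in auto)
  obtain a b where ab: "char_poly ?L = (\<Prod>i=1..n choose k. [:- a i, 1:])"
    "char_poly ?L' = (\<Prod>i=1..n choose k. [:- b i, 1:])"
    "char_poly (?L + ?L') = (\<Prod>i=1..n choose k. [:- (a i + b i), 1:])"
    using symmetric_commuting_char_poly_factorized[OF C comm sym[OF G card(1)] sym[OF G' card(2)]]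
    by blast
  \<comment> \<open>Numbering the vertices by \<open>{1..n}\<close> identifies the token graph of
    \<open>?K\<close> with the Johnson graph, whose characteristic polynomial is therefore that of
    \<open>?L + ?L'\<close>.\<close>
  obtain f where "bij_betw f (pverts G) {1..n}"
    using assms(2) pair_finite_verts by (metis finite_same_card_bij finite_atLeastAtMost card_atLeastAtMost diff_Suc_1)
  from graph_iso_token_graph[OF graph_iso_complete_graph_on[OF this]]
  have "graph_iso ((`) f) (token_graph k ?K) (johnson_graph n k)"
    by (simp add: johnson_graph_def complete_graph_def complete_graph_on_def)
  from char_poly_laplacian_iso[OF this pair_graph_token pair_graph_token[OF pair_graph_complete, folded johnson_graph_def]]
  have "char_poly (laplacian_matrix (johnson_graph n k)) = char_poly (?L + ?L')"
    by (simp add: token_graph_laplacian_add_complement[OF G] pair_graph_complete_graph_on pair_finite_verts)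
  \<comment> \<open>With the third sequence chosen as the pointwise sum, the pairing identity is
    immediate; the content lies in the factorisation for \<open>?L + ?L'\<close>.\<close>
  with ab show ?thesis
    unfolding enumerates_laplacian_eigenvalues_def
    by (intro exI[of _ a] exI[of _ b] exI[of _ "\<lambda>i. a i + b i"]) simp
qed

end
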